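(* Let $\mathcal C\subseteq\mathbb N$ be a (possibly infinite) ruleset with $c_1=\min\mathcal C\ge2$. Then the Sprague-Grundy sequence of the partition game with ruleset $\mathcal C$ is purely arithmetic-periodic with period $c_1$, saltus $1$ and first $c_1$ values equal to $0$; that is, $\mathcal G(n)=0$ for $1\le n\le c_1$ and $\mathcal G(n+c_1)=\mathcal G(n)+1$ for all $n\ge1$.
   Context: $\mathbb N=\{1,2,\ldots\}$ and $\mathbb N_0=\mathbb N\cup\{0\}$. A ruleset is a nonempty set $\mathcal C\subseteq\mathbb N$ of allowed cut-numbers. In the partition game with ruleset $\mathcal C$, positions are finite collections (disjunctive sums) of heaps of positive integer sizes; a move chooses one heap, of size $n$, chooses $c\in\mathcal C$, and replaces that heap by $c+1$ heaps of positive integer sizes $n_0,\ldots,n_c$ with $n_0+\cdots+n_c=n$ (a $c$-cut). The Sprague-Grundy value of a single heap of size $n\ge1$ is defined recursively by $$\mathcal G(n)=\operatorname{mex}\{\mathcal G(n_0)\oplus\cdots\oplus\mathcal G(n_c)\mid c\in\mathcal C,\ n_i\in\mathbb N,\ n_0+\cdots+n_c=n\},$$ where $\oplus$ is nim-sum (bitwise XOR) and $\operatorname{mex}(U)=\min(\mathbb N_0\setminus U)$. *)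

theory Defs
  imports Main
begin

definition ruleset :: "nat set \<Rightarrow> bool" where
  "ruleset C \<longleftrightarrow> C \<noteq> {} \<and> 0 \<notin> C"

definition mex :: "nat set \<Rightarrow> nat" where
  "mex U = (LEAST k. k \<notin> U)"

definition nim_sum :: "nat list \<Rightarrow> nat" where
  "nim_sum xs = foldr Bit_Operations.xor xs 0"

(* Results of a move on a single heap of size n, as lists [n_0, ..., n_c].
   Cut-numbers are positive by convention; the conjunct c >= 1 only makes the
   recursion below total for an arbitrary set C, and is redundant for a ruleset
   (lemma cuts_ruleset). *)
definition cuts :: "nat set \<Rightarrow> nat \<Rightarrow> nat list set" where
  "cuts C n = {ns. (\<exists>c\<in>C. c \<ge> 1 \<and> length ns = c + 1) \<and> (\<forall>m\<in>set ns. m \<ge> 1) \<and> sum_list ns = n}"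

lemma cuts_ruleset:
  assumes "ruleset C"
  shows "cuts C n = {ns. (\<exists>c\<in>C. length ns = c + 1) \<and> (\<forall>m\<in>set ns. m \<ge> 1) \<and> sum_list ns = n}"
proof -
  have "c \<ge> 1" if "c \<in> C" for c
    using assms that unfolding ruleset_def by (cases c) auto
  then show ?thesis
    unfolding cuts_def by blast
qed

lemma cuts_part_less:
  assumes "ns \<in> cuts C n" and "m \<in> set ns"
  shows "m < n"
proof -
  obtain us vs where ns: "ns = us @ m # vs"
    using assms(2) by (auto simp: in_set_conv_decomp)
  obtain x where x: "x \<in> set us \<union> set vs"
    using assms(1) unfolding cuts_def ns by (cases us; cases vs) auto
  then have "x \<ge> 1"
    using assms(1) unfolding cuts_def ns by auto
  moreover have "x \<le> sum_list us + sum_list vs"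
    using x member_le_sum_list[of x us] member_le_sum_list[of x vs] by auto
  moreover have "n = sum_list us + m + sum_list vs"
    using assms(1) unfolding cuts_def ns by auto
  ultimately show ?thesis by linarith
qed

(* Only sizes n >= 1 are heaps; grundy C 0 is an irrelevant value. *)
function grundy :: "nat set \<Rightarrow> nat \<Rightarrow> nat" where
  "grundy C n = mex ((\<lambda>ns. nim_sum (map (\<lambda>m. grundy C m) ns)) ` cuts C n)"
  by auto
termination
  by (relation "measure snd") (auto intro: cuts_part_less)

declare grundy.simps [simp del]

end

theory Submission
  imports Defs
begin

text \<open>
  The closed form behind the theorem is \<open>grundy C n = (n - 1) div c\<close> where \<open>c\<close> is the least
  element of \<open>C\<close>, proved by strong induction on \<open>n\<close>.  Write \<open>q = (n - 1) div c\<close>.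

  \<^item> No option has value \<open>q\<close> (\<open>cut_value_less\<close>): a nim-sum never exceeds the ordinary sum, and
    every part loses 1 before being divided by \<open>c\<close>.  A cut into at least \<open>c + 1\<close> parts thus
    loses at least \<open>c\<close> more than the uncut heap, which costs a full unit after the division,
    so that the ordinary sum of the values is below \<open>q\<close>.
  \<^item> Every \<open>v < q\<close> is the value of an option, already of a \<open>c\<close>-cut (\<open>cut_with_value\<close>): split off one heap of
    value \<open>v\<close>, let a pair of equal heaps, whose values cancel, absorb the remaining size, and
    fill up with heaps of size 1, whose value is 0.  The condition \<open>c \<ge> 2\<close> makes room for the
    pair, and also lets the first heap grow by one unit without changing its value, which
    repairs the parity of what is left for the pair.
\<close>

text \<open>Xor is binary addition with the carries dropped.\<close>
lemma xor_le_add: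
  fixes a b :: nat
  shows "Bit_Operations.xor a b \<le> a + b"
proof (induction a arbitrary: b rule: less_induct)
  case (less a)
  show ?case
  proof (cases "a = 0")
    case False
    have "Bit_Operations.xor (a div 2) (b div 2) \<le> a div 2 + b div 2"
      using less False by simp
    moreover have "Bit_Operations.xor a b =
        of_bool (odd a \<noteq> odd b) + 2 * Bit_Operations.xor (a div 2) (b div 2)"
      by (rule xor_rec)
    moreover have "of_bool (odd a \<noteq> odd b) \<le> a mod 2 + b mod 2"
      by (auto simp: odd_iff_mod_2_eq_one)
    ultimately show ?thesis
      using mult_div_mod_eq[of 2 a] mult_div_mod_eq[of 2 b] by linarith
  qed simp
qed

lemma nim_sum_le_sum_list: "nim_sum xs \<le> sum_list xs"
proof (induction xs)
  case (Cons x xs)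
  then show ?case
    using xor_le_add[of x "nim_sum xs"] by (simp add: nim_sum_def)
qed (simp add: nim_sum_def)

lemma nim_sum_replicate_0: "nim_sum (replicate k 0) = 0"
  by (induction k) (simp_all add: nim_sum_def)

lemma mex_eqI:
  assumes "q \<notin> U" and "\<And>v. v < q \<Longrightarrow> v \<in> U"
  shows "mex U = q"
  unfolding mex_def using assms by (intro Least_equality) (auto simp: not_less[symmetric])

lemma sum_list_quotients_bound:
  fixes c :: nat
  assumes "\<forall>m\<in>set ns. m \<ge> 1"
  shows "c * sum_list (map (\<lambda>m. (m - 1) div c) ns) + length ns \<le> sum_list ns"
  using assms
proof (induction ns)
  case (Cons m ns)
  have "c * ((m - 1) div c) \<le> m - 1"
    by simp
  moreover have "m \<ge> 1"
    using Cons.prems by simp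
  ultimately have "c * ((m - 1) div c) + 1 \<le> m"
    by linarith
  with Cons show ?case
    by (simp add: distrib_left)
qed simp

lemma cut_value_less:
  fixes c :: nat
  assumes "ns \<in> cuts C n" and "\<And>k. k \<in> C \<Longrightarrow> c \<le> k" and "c \<ge> 1"
  shows "nim_sum (map (\<lambda>m. (m - 1) div c) ns) < (n - 1) div c"
proof -
  let ?s = "sum_list (map (\<lambda>m. (m - 1) div c) ns)"
  have "c + 1 \<le> length ns" and "\<forall>m\<in>set ns. m \<ge> 1" and n: "sum_list ns = n"
    using assms unfolding cuts_def by auto
  then have "(?s + 1) * c \<le> n - 1"
    using sum_list_quotients_bound[of ns c] by (simp add: algebra_simps)
  then have "?s + 1 \<le> (n - 1) div c"
    using \<open>c \<ge> 1\<close> by (simp add: less_eq_div_iff_mult_less_eq)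
  then show ?thesis
    using nim_sum_le_sum_list[of "map (\<lambda>m. (m - 1) div c) ns"] by linarith
qed

text \<open>
  The cut is \<open>v * c + 1 + s, a, a, 1, \<dots>, 1\<close>.  Once the heap of value \<open>v\<close> has its least size
  \<open>v * c + 1\<close> and all \<open>c\<close> other parts have size 1, a surplus of \<open>D = n - 1 - (v + 1) * c \<ge> 0\<close>
  remains; the pair takes the even part of \<open>D\<close>, and \<open>s = D mod 2 < c\<close> goes to the first heap.
\<close>
lemma cut_with_value:
  fixes c :: nat
  assumes "c \<in> C" and "c \<ge> 2" and "v < (n - 1) div c"
  shows "\<exists>ns \<in> cuts C n. nim_sum (map (\<lambda>m. (m - 1) div c) ns) = v"
proof -
  define D where "D = n - 1 - (v + 1) * c"
  define s where "s = D mod 2"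
  define a where "a = D div 2 + 1"
  define ns where "ns = (v * c + 1 + s) # a # a # replicate (c - 2) 1"
  have "(v + 1) * c \<le> n - 1"
    using assms less_eq_div_iff_mult_less_eq[of c "v + 1" "n - 1"] by simp
  then have D: "n = D + 1 + v * c + c"
    using \<open>c \<ge> 2\<close> by (simp add: D_def algebra_simps)
  have "D = s + 2 * (D div 2)"
    unfolding s_def by simp
  then have "sum_list ns = n"
    using D \<open>c \<ge> 2\<close> by (simp add: ns_def a_def sum_list_replicate)
  moreover have "length ns = c + 1" and "\<forall>m\<in>set ns. m \<ge> 1"
    using \<open>c \<ge> 2\<close> by (auto simp: ns_def a_def)
  ultimately have "ns \<in> cuts C n"
    using assms unfolding cuts_def by auto
  moreover have "(v * c + s) div c = v"
    using \<open>c \<ge> 2\<close> by (simp add: s_def)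
  then have "nim_sum (map (\<lambda>m. (m - 1) div c) ns) = v"
    using nim_sum_replicate_0[of "c - 2"]
    by (simp add: ns_def nim_sum_def xor.assoc[symmetric])
  ultimately show ?thesis
    by blast
qed

lemma grundy_eq_div:
  fixes c :: nat
  assumes "c \<in> C" and "\<And>k. k \<in> C \<Longrightarrow> c \<le> k" and "c \<ge> 2"
  shows "grundy C n = (n - 1) div c"
proof (induction n rule: less_induct)
  case (less n)
  have option_value: "nim_sum (map (grundy C) ns) = nim_sum (map (\<lambda>m. (m - 1) div c) ns)"
    if "ns \<in> cuts C n" for ns
    using less cuts_part_less[OF that] by (metis (no_types, lifting) map_eq_conv)
  have "mex ((\<lambda>ns. nim_sum (map (grundy C) ns)) ` cuts C n) = (n - 1) div c"
  proof (rule mex_eqI)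
    show "(n - 1) div c \<notin> (\<lambda>ns. nim_sum (map (grundy C) ns)) ` cuts C n"
      using option_value cut_value_less[of _ C n c] assms by fastforce
  next
    fix v assume "v < (n - 1) div c"
    then show "v \<in> (\<lambda>ns. nim_sum (map (grundy C) ns)) ` cuts C n"
      using option_value cut_with_value[OF assms(1,3)] by force
  qed
  then show ?case
    by (simp add: grundy.simps[of C n])
qed

theorem proposition6:
  fixes C :: "nat set" and c1 :: nat
  assumes "ruleset C"
    and "c1 = (LEAST c. c \<in> C)"
    and "c1 \<ge> 2"
  shows "(\<forall>n. 1 \<le> n \<and> n \<le> c1 \<longrightarrow> grundy C n = 0) \<and>
         (\<forall>n\<ge>1. grundy C (n + c1) = grundy C n + 1)"
proof -
  have "c1 \<in> C"
    using assms unfolding ruleset_def by (auto intro: LeastI)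
  moreover have "c1 \<le> k" if "k \<in> C" for k
    using that assms(2) by (simp add: Least_le)
  ultimately have "grundy C n = (n - 1) div c1" for n
    using grundy_eq_div \<open>c1 \<ge> 2\<close> by blast
  moreover have "(n + c1 - 1) div c1 = (n - 1) div c1 + 1" if "n \<ge> 1" for n
  proof -
    have "n + c1 - 1 = (n - 1) + c1"
      using that by simp
    then show ?thesis
      using \<open>c1 \<ge> 2\<close> by (simp only: div_add_self2)
  qed
  ultimately show ?thesis
    by auto
qed

end
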